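(* Fix an integer $N>0$ and $N$-tuples $\mathbf{m}=(m_0,\dots,m_{N-1})$, $\mathbf{n}=(n_0,\dots,n_{N-1})$ of real numbers, each tuple having pairwise distinct coordinates. Then the following are equivalent. (1) For all vectors $\mathbf{u} \in [1,+\infty)^N$, we have $$\frac{|\det (\mathbf{u}^{\circ m_0} | \dots | \mathbf{u}^{\circ m_{N-1}})|}{|V(\mathbf{m})|} \geqslant \frac{|\det (\mathbf{u}^{\circ n_0} | \dots | \mathbf{u}^{\circ n_{N-1}})|}{|V(\mathbf{n})|}.$$ (2) The tuple $\mathbf{m}$ weakly majorizes $\mathbf{n}$.
   Context: For $\mathbf{u}=(u_1,\dots,u_N)^T$ with positive coordinates and real $\alpha$, $\mathbf{u}^{\circ \alpha} := (u_1^\alpha,\dots,u_N^\alpha)^T$; $(\mathbf{u}^{\circ m_0} | \dots | \mathbf{u}^{\circ m_{N-1}})$ is the $N\times N$ matrix with these columns. For a tuple $(t_0,\dots,t_{N-1})$, $V(t_0,\dots,t_{N-1}) := \prod_{0 \leqslant i < j \leqslant N-1} (t_j - t_i)$. For real $N$-tuples, let $x_{[1]} \geqslant \cdots \geqslant x_{[N]}$ denote the decreasing rearrangement of the coordinates of $\mathbf{x}$; then $\mathbf{x}$ weakly majorizes $\mathbf{y}$ if $\sum_{j=1}^k x_{[j]} \geqslant \sum_{j=1}^k y_{[j]}$ for all $1 \leqslant k \leqslant N$. *)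

theory Defs
  imports Complex_Main "Jordan_Normal_Form.Determinant"
begin

text \<open>An \<open>N\<close>-tuple is the restriction to indices \<open>i < N\<close> of a function on \<open>nat\<close>;
  values at indices \<open>i \<ge> N\<close> are ignored. The exponents are real, so the entrywise powers use
  \<open>powr\<close>, which is the usual real power for a positive base.\<close>

definition gen_vandermonde_mat :: "nat \<Rightarrow> (nat \<Rightarrow> real) \<Rightarrow> (nat \<Rightarrow> real) \<Rightarrow> real mat" where
  "gen_vandermonde_mat N u m = mat N N (\<lambda>(i, j). u i powr m j)"

definition vandermonde_prod :: "nat \<Rightarrow> (nat \<Rightarrow> real) \<Rightarrow> real" where
  "vandermonde_prod N t = (\<Prod>j<N. \<Prod>i<j. t j - t i)"

text \<open>Entries of the list are indexed from \<open>0\<close>, so entry \<open>j\<close> is $x_{[j+1]}$.\<close>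

definition decreasing_rearrangement :: "nat \<Rightarrow> (nat \<Rightarrow> real) \<Rightarrow> real list" where
  "decreasing_rearrangement N x = rev (sort (map x [0..<N]))"

definition weakly_majorizes :: "nat \<Rightarrow> (nat \<Rightarrow> real) \<Rightarrow> (nat \<Rightarrow> real) \<Rightarrow> bool" where
  "weakly_majorizes N x y \<longleftrightarrow>
     (\<forall>k\<in>{1..N}. (\<Sum>j<k. decreasing_rearrangement N x ! j)
                 \<ge> (\<Sum>j<k. decreasing_rearrangement N y ! j))"

end

theory Submission
  imports Defs
begin

text \<open>Put \<open>u i = exp (x i)\<close> with \<open>x i \<ge> 0\<close>; then the matrix has the entries \<open>exp (m j * x i)\<close>. Write
  \<open>R(m)\<close> for the absolute value of its determinant divided by that of the Vandermonde product
  of \<open>m\<close>. It is symmetric in the exponents and in the points, so the points may be taken increasing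
  and both tuples strictly decreasing.

  Majorization implies the inequality because \<open>R\<close> increases when a single exponent is raised, and
  when two exponents are moved apart about their midpoint. Both facts come from one comparison
  principle, \<open>exp_det_compare\<close>. A shared exponent can be removed from a determinant: factor it out
  so that its column becomes a column of ones, subtract consecutive rows, and read each difference
  of exponentials as an integral. The determinant becomes the product of the differences to the
  removed exponent times an integral of smaller determinants over points that interlace the given
  ones. Hence an inequality for the exponents that are not shared lifts to the full determinants.
  For one such exponent the inequality says that \<open>exp (a * y)\<close> increases in \<open>a\<close> for \<open>y \<ge> 0\<close>; for two
  of them it says that \<open>sinh (s * d) / s\<close> increases in \<open>s > 0\<close>; for none it gives the positivity of
  the determinant. If \<open>m\<close> weakly majorizes \<open>n\<close>, the segment from \<open>n\<close> to \<open>m\<close> consists of strictly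
  decreasing tuples, and by Abel summation each short piece of it splits into moves of these two
  kinds (\<open>vandermonde_ratio_mono_majorize\<close>).

  Conversely, along a ray \<open>x = T * y\<close> with \<open>y\<close> strictly decreasing the determinant is asymptotic to
  \<open>exp (T * (\<Sum>i. y i * m i))\<close>, by the strict rearrangement inequality (\<open>exp_det_asymptotics\<close>). So the
  inequality forces \<open>(\<Sum>i. y i * n i) \<le> (\<Sum>i. y i * m i)\<close> for all such \<open>y \<ge> 0\<close>. When \<open>y\<close> tends to the
  indicator of the first \<open>k\<close> indices, this becomes the \<open>k\<close>-th majorization inequality
  (\<open>majorize_of_vandermonde_ratio_le\<close>).\<close>

section \<open>Determinants under row and column operations\<close>

lemma det_mat_scale:
  fixes f :: "nat \<Rightarrow> nat \<Rightarrow> real"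
  shows "det (mat n n (\<lambda>(i, j). r i * f i j * s j))
       = (\<Prod>i<n. r i) * (\<Prod>j<n. s j) * det (mat n n (\<lambda>(i, j). f i j))"
proof -
  have "(\<Prod>i=0..<n. r i * f i (p i) * s (p i))
      = (\<Prod>i<n. r i) * (\<Prod>j<n. s j) * (\<Prod>i=0..<n. f i (p i))" if p: "p permutes {0..<n}" for p
  proof -
    have "(\<Prod>i=0..<n. s (p i)) = (\<Prod>j<n. s j)"
      using prod.permute[OF p, of s] by (simp add: o_def lessThan_atLeast0)
    thus ?thesis by (simp add: prod.distrib lessThan_atLeast0)
  qed
  hence "signof p * (\<Prod>i=0..<n. r i * f i (p i) * s (p i))
      = (\<Prod>i<n. r i) * (\<Prod>j<n. s j) * (signof p * (\<Prod>i=0..<n. f i (p i)))"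
    if "p permutes {0..<n}" for p
    using that by (simp add: algebra_simps)
  moreover have "(\<Prod>i=0..<n. mat n n (\<lambda>(i, j). h i j) $$ (i, p i)) = (\<Prod>i=0..<n. h i (p i))"
    if p: "p permutes {0..<n}" for p and h :: "nat \<Rightarrow> nat \<Rightarrow> real"
    using p by (intro prod.cong) (auto simp: permutes_in_image)
  ultimately show ?thesis
    by (subst (1 2) det_def'[of _ n]) (auto simp: sum_distrib_left intro!: sum.cong)
qed

text \<open>Expansion along row \<open>k\<close>: the coefficients do not see that row. This lets row \<open>k\<close> vary with
  a parameter, so that the determinant becomes a linear combination of functions that can be
  differentiated.\<close>
lemma det_mat_row_linear:
  fixes h :: "nat \<Rightarrow> nat \<Rightarrow> real"
  assumes "k < n"
  obtains C where "\<And>f. det (mat n n (\<lambda>(i, j). if i = k then f j else h i j)) = (\<Sum>j<n. f j * C j)"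
proof
  fix f
  let ?M = "\<lambda>f. mat n n (\<lambda>(i, j). if i = k then f j else h i j)"
  have "mat_delete (?M f) k j = mat_delete (?M (\<lambda>_. 0)) k j" for j
    by (rule eq_matI) (auto simp: mat_delete_def)
  hence "cofactor (?M f) k j = cofactor (?M (\<lambda>_. 0)) k j" for j
    by (simp add: cofactor_def)
  thus "det (?M f) = (\<Sum>j<n. f j * cofactor (?M (\<lambda>_. 0)) k j)"
    using laplace_expansion_row[of "?M f" n k] assms by simp
qed

text \<open>Subtracting from each row the one above it, that is, multiplying by a unipotent bidiagonal
  matrix, clears the column of ones except for its top entry.\<close>
lemma det_ones_column:
  fixes f :: "nat \<Rightarrow> nat \<Rightarrow> real"
  shows "det (mat (Suc n) (Suc n) (\<lambda>(i, j). case j of 0 \<Rightarrow> 1 | Suc j \<Rightarrow> f i j))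
       = det (mat n n (\<lambda>(i, j). f (Suc i) j - f i j))"
proof -
  let ?A = "mat (Suc n) (Suc n) (\<lambda>(i, j). case j of 0 \<Rightarrow> 1 | Suc j \<Rightarrow> f i j)"
  let ?L = "mat (Suc n) (Suc n) (\<lambda>(i, j). if i = j then 1 else if i = Suc j then -1 else 0 :: real)"
  let ?B = "mat (Suc n) (Suc n) (\<lambda>(i, j). if i = 0 then ?A $$ (0, j) else ?A $$ (i, j) - ?A $$ (i - 1, j))"
  have LA: "?L * ?A = ?B"
  proof (rule eq_matI)
    fix i j assume "i < dim_row ?B" "j < dim_col ?B"
    hence i: "i < Suc n" and j: "j < Suc n" by auto
    have "(?L * ?A) $$ (i, j) = (\<Sum>k\<in>{0..<Suc n}. ?L $$ (i, k) * ?A $$ (k, j))"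
      using i j by (simp add: scalar_prod_def)
    also have "\<dots> = (\<Sum>k\<in>{0..<Suc n}. (if k = i then ?A $$ (i, j) else 0)
                     - (if i = Suc k then ?A $$ (k, j) else 0))"
      using i j by (intro sum.cong) auto
    also have "\<dots> = ?A $$ (i, j) - (\<Sum>k\<in>{0..<Suc n}. if i = Suc k then ?A $$ (k, j) else 0)"
      using i by (simp add: sum_subtractf del: index_mat)
    also have "(\<Sum>k\<in>{0..<Suc n}. if i = Suc k then ?A $$ (k, j) else 0)
             = (if i = 0 then 0 else ?A $$ (i - 1, j))"
      using i by (cases i) (simp_all del: index_mat)
    finally show "(?L * ?A) $$ (i, j) = ?B $$ (i, j)"
      using i j by (cases "i = 0") simp_all
  qed auto
  have "det ?L = 1"
    by (subst det_lower_triangular[of "Suc n"]) (auto simp: prod_list_diag_prod)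
  hence "det ?A = det ?B"
    using det_mult[of ?L "Suc n" ?A] LA by simp
  also have "\<dots> = (\<Sum>i<Suc n. ?B $$ (i, 0) * cofactor ?B i 0)"
    by (rule laplace_expansion_column) auto
  also have "\<dots> = (\<Sum>i<Suc n. if i = 0 then cofactor ?B 0 0 else 0)"
    by (intro sum.cong) auto
  also have "\<dots> = det (mat_delete ?B 0 0)"
    by (simp add: cofactor_def)
  also have "mat_delete ?B 0 0 = mat n n (\<lambda>(i, j). f (Suc i) j - f i j)"
    by (rule eq_matI) (auto simp: mat_delete_def)
  finally show ?thesis .
qed

text \<open>The determinant of increments is the integral of the determinant of derivatives over the box
  of all \<open>y\<close> with \<open>y i\<close> between \<open>x i\<close> and \<open>x (Suc i)\<close>, so an inequality that holds pointwise on
  the box survives. In place of the multiple integral, the proof turns the derivative rows into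
  increment rows one at a time; each such step is monotonicity in a single real variable.\<close>
lemma det_increments_mono:
  fixes x :: "nat \<Rightarrow> real"
  assumes f: "\<And>j t. (f j has_real_derivative f' j t) (at t)"
      and g: "\<And>j t. (g j has_real_derivative g' j t) (at t)"
      and x: "\<And>i. i < n \<Longrightarrow> x i \<le> x (Suc i)"
      and le: "\<And>y. (\<And>i. i < n \<Longrightarrow> x i \<le> y i \<and> y i \<le> x (Suc i)) \<Longrightarrow>
                 c * det (mat n n (\<lambda>(i, j). f' j (y i))) \<le> d * det (mat n n (\<lambda>(i, j). g' j (y i)))"
  shows "c * det (mat n n (\<lambda>(i, j). f j (x (Suc i)) - f j (x i)))
       \<le> d * det (mat n n (\<lambda>(i, j). g j (x (Suc i)) - g j (x i)))"
proof -
  let ?F = "\<lambda>k y. mat n n (\<lambda>(i, j). if i < k then f' j (y i) else f j (x (Suc i)) - f j (x i))"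
  let ?G = "\<lambda>k y. mat n n (\<lambda>(i, j). if i < k then g' j (y i) else g j (x (Suc i)) - g j (x i))"
  \<comment> \<open>Rows with index below \<open>k\<close> are derivatives at \<open>y\<close>, the others are increments; \<open>k\<close> descends from \<open>n\<close>
    to \<open>0\<close>.\<close>
  have "c * det (?F k y) \<le> d * det (?G k y)"
    if "k \<le> n" "\<And>i. i < k \<Longrightarrow> x i \<le> y i \<and> y i \<le> x (Suc i)" for k y
    using that
  proof (induction k arbitrary: y rule: inc_induct)
    case base
    have eq: "mat n n (\<lambda>(i, j). if i < n then a i j else b i j) = mat n n (\<lambda>(i, j). a i j)"
      for a b :: "nat \<Rightarrow> nat \<Rightarrow> real" by (rule eq_matI) auto
    show ?case
      unfolding eq using le[of y] base by blast
  next
    case (step k)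
    obtain C where C: "\<And>h. det (mat n n (\<lambda>(i, j). if i = k then h j
        else if i < k then f' j (y i) else f j (x (Suc i)) - f j (x i))) = (\<Sum>j<n. h j * C j)"
      by (rule det_mat_row_linear[OF step.hyps(2),
            where h = "\<lambda>i j. if i < k then f' j (y i) else f j (x (Suc i)) - f j (x i)"]) auto
    obtain E where E: "\<And>h. det (mat n n (\<lambda>(i, j). if i = k then h j
        else if i < k then g' j (y i) else g j (x (Suc i)) - g j (x i))) = (\<Sum>j<n. h j * E j)"
      by (rule det_mat_row_linear[OF step.hyps(2),
            where h = "\<lambda>i j. if i < k then g' j (y i) else g j (x (Suc i)) - g j (x i)"]) auto
    define \<phi> where "\<phi> t = d * (\<Sum>j<n. g j t * E j) - c * (\<Sum>j<n. f j t * C j)" for t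
    define \<phi>' where "\<phi>' t = d * (\<Sum>j<n. g' j t * E j) - c * (\<Sum>j<n. f' j t * C j)" for t
    have "\<phi> (x k) \<le> \<phi> (x (Suc k))"
    proof (rule DERIV_nonneg_imp_nondecreasing[where f = \<phi>])
      show "x k \<le> x (Suc k)" by (rule x) (rule step.hyps)
      fix t assume t: "x k \<le> t" "t \<le> x (Suc k)"
      have "(\<phi> has_real_derivative \<phi>' t) (at t)"
        unfolding \<phi>_def \<phi>'_def by (auto intro!: derivative_eq_intros f g)
      moreover have "c * det (?F (Suc k) (y(k := t))) \<le> d * det (?G (Suc k) (y(k := t)))"
        using t step.prems by (intro step.IH) (auto simp: less_Suc_eq)
      moreover have "?F (Suc k) (y(k := t)) = mat n n (\<lambda>(i, j). if i = k then f' j t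
        else if i < k then f' j (y i) else f j (x (Suc i)) - f j (x i))"
        by (rule eq_matI) auto
      moreover have "?G (Suc k) (y(k := t)) = mat n n (\<lambda>(i, j). if i = k then g' j t
        else if i < k then g' j (y i) else g j (x (Suc i)) - g j (x i))"
        by (rule eq_matI) auto
      ultimately show "\<exists>z. (\<phi> has_real_derivative z) (at t) \<and> 0 \<le> z"
        unfolding \<phi>'_def by (intro exI[of _ "\<phi>' t"]) (simp add: C E \<phi>'_def)
    qed
    moreover have "det (?F k y) = (\<Sum>j<n. (f j (x (Suc k)) - f j (x k)) * C j)"
      by (subst C[symmetric]) (rule arg_cong[where f = det], rule eq_matI, auto)
    moreover have "det (?G k y) = (\<Sum>j<n. (g j (x (Suc k)) - g j (x k)) * E j)"
      by (subst E[symmetric]) (rule arg_cong[where f = det], rule eq_matI, auto)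
    ultimately show ?case
      by (simp add: \<phi>_def left_diff_distrib sum_subtractf right_diff_distrib)
  qed
  from this[of 0] show ?thesis by simp
qed

section \<open>Comparing exponential determinants with common exponents\<close>

definition exp_det :: "nat \<Rightarrow> (nat \<Rightarrow> real) \<Rightarrow> (nat \<Rightarrow> real) \<Rightarrow> real" where
  "exp_det N x a = det (mat N N (\<lambda>(i, j). exp (a j * x i)))"

lemma exp_det_shift:
  "exp_det N x (\<lambda>j. a j - s) = exp (- s * (\<Sum>i<N. x i)) * exp_det N x a"
proof -
  have "exp ((a j - s) * x i) = exp (- s * x i) * exp (a j * x i) * 1" for i j
    by (simp add: exp_add[symmetric] algebra_simps)
  hence "exp_det N x (\<lambda>j. a j - s) = (\<Prod>i<N. exp (- s * x i)) * exp_det N x a"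
    unfolding exp_det_def by (simp only: det_mat_scale) simp
  thus ?thesis by (simp add: exp_sum[symmetric] sum_distrib_left sum_negf)
qed

text \<open>Dividing row \<open>i\<close> by \<open>exp (a 0 * x i)\<close> turns the first column into ones, which leaves differences
  of exponentials. Dividing these by their exponents makes them increments of antiderivatives of
  the pure exponentials \<open>\<lambda>t. exp ((a (Suc j) - a 0) * t)\<close>: one size less, of the same kind.\<close>
lemma exp_det_peel:
  assumes "\<And>j. j < n \<Longrightarrow> a (Suc j) \<noteq> a 0"
  shows "exp_det (Suc n) x a = exp (a 0 * (\<Sum>i<Suc n. x i)) * (\<Prod>j<n. a (Suc j) - a 0)
    * det (mat n n (\<lambda>(i, j). exp ((a (Suc j) - a 0) * x (Suc i)) / (a (Suc j) - a 0)
                             - exp ((a (Suc j) - a 0) * x i) / (a (Suc j) - a 0)))"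
proof -
  have "exp_det (Suc n) x a = exp (a 0 * (\<Sum>i<Suc n. x i)) * exp_det (Suc n) x (\<lambda>j. a j - a 0)"
    unfolding exp_det_shift by (simp add: mult.assoc[symmetric] exp_add[symmetric])
  also have "exp_det (Suc n) x (\<lambda>j. a j - a 0)
      = det (mat (Suc n) (Suc n) (\<lambda>(i, j). case j of 0 \<Rightarrow> 1 | Suc j \<Rightarrow> exp ((a (Suc j) - a 0) * x i)))"
    unfolding exp_det_def
    by (intro arg_cong[where f = det] eq_matI) (auto split: nat.splits)
  also have "\<dots> = det (mat n n (\<lambda>(i, j). exp ((a (Suc j) - a 0) * x (Suc i)) - exp ((a (Suc j) - a 0) * x i)))"
    by (rule det_ones_column)
  also have "\<dots> = det (mat n n (\<lambda>(i, j). 1 * (exp ((a (Suc j) - a 0) * x (Suc i)) / (a (Suc j) - a 0)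
                             - exp ((a (Suc j) - a 0) * x i) / (a (Suc j) - a 0)) * (a (Suc j) - a 0)))"
    using assms by (intro arg_cong[where f = det] eq_matI) (auto simp: diff_divide_distrib[symmetric])
  also have "\<dots> = (\<Prod>j<n. a (Suc j) - a 0)
    * det (mat n n (\<lambda>(i, j). exp ((a (Suc j) - a 0) * x (Suc i)) / (a (Suc j) - a 0)
                             - exp ((a (Suc j) - a 0) * x i) / (a (Suc j) - a 0)))"
    by (subst det_mat_scale) simp
  finally show ?thesis by (simp add: mult.assoc)
qed

text \<open>The part of the Vandermonde product that involves one of the first \<open>K\<close> entries. Peeling off
  these entries successively produces exactly these factors.\<close>
definition partial_vandermonde :: "nat \<Rightarrow> nat \<Rightarrow> (nat \<Rightarrow> real) \<Rightarrow> real" where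
  "partial_vandermonde K N a = (\<Prod>i<K. \<Prod>j\<in>{i<..<N}. a j - a i)"

lemma partial_vandermonde_peel:
  "partial_vandermonde (Suc K) (Suc n) a
     = (\<Prod>j<n. a (Suc j) - a 0) * partial_vandermonde K n (\<lambda>j. a (Suc j) - a 0)"
proof -
  have "k \<in> {0<..<Suc n} \<longleftrightarrow> k \<in> Suc ` {..<n}" for k
    by (cases k) auto
  hence 0: "{0<..<Suc n} = Suc ` {..<n}" by blast
  have "k \<in> {Suc i<..<Suc n} \<longleftrightarrow> k \<in> Suc ` {i<..<n}" for i k
    by (cases k) auto
  hence S: "{Suc i<..<Suc n} = Suc ` {i<..<n}" for i by blast
  show ?thesis
    unfolding partial_vandermonde_def
    by (subst prod.lessThan_Suc_shift) (simp add: 0 S prod.reindex)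
qed

text \<open>The core of the proof. Two tuples share their first \<open>K\<close> exponents; an inequality between the
  small determinants of the remaining \<open>r\<close> exponents lifts to the full determinants once these are
  divided by the differences that involve shared exponents. Removing the shared exponent \<open>a 0\<close>
  expresses both sides as integrals of smaller determinants over the same points interlacing \<open>x\<close>,
  times the same positive factor. The hypothesis survives the shift by \<open>a 0\<close>, because the shift
  multiplies both of its sides by the same positive factor, and it stays confined to nonnegative
  monotone points, because interlacing points are again of this kind.\<close>
lemma exp_det_compare:
  fixes a b x :: "nat \<Rightarrow> real"
  assumes "inj_on a {..<K + r}" "inj_on b {..<K + r}"
      and "\<And>k. k < K \<Longrightarrow> a k = b k"
      and "\<And>y. mono_on {..<r} y \<Longrightarrow> (\<forall>i<r. 0 \<le> y i) \<Longrightarrow>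
             c * exp_det r y (\<lambda>j. a (K + j)) \<le> d * exp_det r y (\<lambda>j. b (K + j))"
      and "mono_on {..<K + r} x" "\<forall>i<K + r. 0 \<le> x i"
  shows "c * (exp_det (K + r) x a / partial_vandermonde K (K + r) a)
       \<le> d * (exp_det (K + r) x b / partial_vandermonde K (K + r) b)"
  using assms
proof (induction K arbitrary: a b x)
  case 0
  from "0.prems"(4)[of x] "0.prems"(5,6) show ?case by (simp add: partial_vandermonde_def)
next
  case (Suc K)
  let ?n = "K + r"
  define a' where "a' j = a (Suc j) - a 0" for j
  define b' where "b' j = b (Suc j) - b 0" for j
  have a0: "b 0 = a 0" using Suc.prems(3)[of 0] by simp
  have na: "a' j \<noteq> 0" if "j < ?n" for j
    using inj_onD[OF Suc.prems(1), of "Suc j" 0] that by (auto simp: a'_def)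
  have nb: "b' j \<noteq> 0" if "j < ?n" for j
    using inj_onD[OF Suc.prems(2), of "Suc j" 0] that by (auto simp: b'_def)
  have ia: "inj_on a' {..<?n}"
    using inj_onD[OF Suc.prems(1)] by (intro inj_onI) (force simp: a'_def)
  have ib: "inj_on b' {..<?n}"
    using inj_onD[OF Suc.prems(2)] by (intro inj_onI) (force simp: b'_def)
  have IH: "c * (exp_det ?n y a' / partial_vandermonde K ?n a')
          \<le> d * (exp_det ?n y b' / partial_vandermonde K ?n b')"
    if y: "mono_on {..<?n} y" "\<forall>i<?n. 0 \<le> y i" for y
  proof (rule Suc.IH[OF ia ib _ _ y])
    show "a' k = b' k" if "k < K" for k
      using Suc.prems(3)[of "Suc k"] that a0 by (simp add: a'_def b'_def)
    fix z :: "nat \<Rightarrow> real" assume z: "mono_on {..<r} z" "\<forall>i<r. 0 \<le> z i"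
    have "exp (- a 0 * (\<Sum>i<r. z i)) * (c * exp_det r z (\<lambda>j. a (Suc K + j)))
        \<le> exp (- a 0 * (\<Sum>i<r. z i)) * (d * exp_det r z (\<lambda>j. b (Suc K + j)))"
      by (intro mult_left_mono Suc.prems(4) z) simp
    thus "c * exp_det r z (\<lambda>j. a' (K + j)) \<le> d * exp_det r z (\<lambda>j. b' (K + j))"
      by (simp add: a'_def b'_def exp_det_shift a0 mult.left_commute)
  qed
  have step: "x i \<le> x (Suc i)" if "i < ?n" for i
    using Suc.prems(5) that by (auto simp: mono_on_def)
  have "c / partial_vandermonde K ?n a' * det (mat ?n ?n (\<lambda>(i, j). exp (a' j * x (Suc i)) / a' j - exp (a' j * x i) / a' j))
      \<le> d / partial_vandermonde K ?n b' * det (mat ?n ?n (\<lambda>(i, j). exp (b' j * x (Suc i)) / b' j - exp (b' j * x i) / b' j))"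
  proof -
    \<comment> \<open>Antiderivatives of \<open>\<lambda>t. exp (p j * t)\<close>; the case \<open>p j = 0\<close> arises only for indices outside
      the matrix.\<close>
    define f where "f p j t = (if p j = 0 then t else exp (p j * t) / p j)" for p :: "nat \<Rightarrow> real" and j and t :: real
    have f': "(f p j has_real_derivative exp (p j * t)) (at t)" for p j t
      unfolding f_def by (cases "p j = 0") (auto intro!: derivative_eq_intros)
    have eq: "mat ?n ?n (\<lambda>(i, j). exp (p j * x (Suc i)) / p j - exp (p j * x i) / p j)
      = mat ?n ?n (\<lambda>(i, j). f p j (x (Suc i)) - f p j (x i))" if "\<And>j. j < ?n \<Longrightarrow> p j \<noteq> 0" for p
      using that by (intro eq_matI) (auto simp: f_def)
    show ?thesis
    proof (subst eq, erule na, subst eq, erule nb, rule det_increments_mono[where f = "f a'" and f' = "\<lambda>j t. exp (a' j * t)"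
          and g = "f b'" and g' = "\<lambda>j t. exp (b' j * t)" and x = x, OF f' f'])
      show "x i \<le> x (Suc i)" if "i < ?n" for i by (rule step[OF that])
    next
      fix y assume y: "\<And>i. i < ?n \<Longrightarrow> x i \<le> y i \<and> y i \<le> x (Suc i)"
      have "y i \<le> y j" if "i \<le> j" "j < ?n" for i j
      proof (cases "i = j")
        case False
        have "y i \<le> x (Suc i)" using y[of i] that by simp
        also have "\<dots> \<le> x j" using Suc.prems(5) that False by (auto simp: mono_on_def)
        also have "\<dots> \<le> y j" using y[of j] that by simp
        finally show ?thesis .
      qed simp
      hence "mono_on {..<?n} y" by (auto simp: mono_on_def)
      moreover have "\<forall>i<?n. 0 \<le> y i"
        using y Suc.prems(6) by (metis add_Suc less_SucI order_trans)
      ultimately show "c / partial_vandermonde K ?n a' * det (mat ?n ?n (\<lambda>(i, j). exp (a' j * y i)))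
         \<le> d / partial_vandermonde K ?n b' * det (mat ?n ?n (\<lambda>(i, j). exp (b' j * y i)))"
        using IH[of y] by (simp add: exp_det_def)
    qed
  qed
  hence "exp (a 0 * (\<Sum>i<Suc ?n. x i)) * (c / partial_vandermonde K ?n a' * det (mat ?n ?n (\<lambda>(i, j). exp (a' j * x (Suc i)) / a' j - exp (a' j * x i) / a' j)))
      \<le> exp (a 0 * (\<Sum>i<Suc ?n. x i)) * (d / partial_vandermonde K ?n b' * det (mat ?n ?n (\<lambda>(i, j). exp (b' j * x (Suc i)) / b' j - exp (b' j * x i) / b' j)))"
    by (intro mult_left_mono) auto
  moreover have "exp_det (Suc ?n) x p / partial_vandermonde (Suc K) (Suc ?n) p
      = exp (p 0 * (\<Sum>i<Suc ?n. x i)) * (1 / partial_vandermonde K ?n (\<lambda>j. p (Suc j) - p 0) *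
          det (mat ?n ?n (\<lambda>(i, j). exp ((p (Suc j) - p 0) * x (Suc i)) / (p (Suc j) - p 0)
                             - exp ((p (Suc j) - p 0) * x i) / (p (Suc j) - p 0))))"
    if "\<And>j. j < ?n \<Longrightarrow> p (Suc j) \<noteq> p 0" for p
  proof -
    have "(\<Prod>j<?n. p (Suc j) - p 0) \<noteq> 0" using that by simp
    thus ?thesis
      by (simp only: exp_det_peel[OF that] partial_vandermonde_peel) (simp add: field_simps)
  qed
  note ratio = this
  have "exp_det (Suc ?n) x a / partial_vandermonde (Suc K) (Suc ?n) a
      = exp (a 0 * (\<Sum>i<Suc ?n. x i)) * (1 / partial_vandermonde K ?n a' *
          det (mat ?n ?n (\<lambda>(i, j). exp (a' j * x (Suc i)) / a' j - exp (a' j * x i) / a' j)))"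
    using ratio[of a] na unfolding a'_def by simp
  moreover have "exp_det (Suc ?n) x b / partial_vandermonde (Suc K) (Suc ?n) b
      = exp (a 0 * (\<Sum>i<Suc ?n. x i)) * (1 / partial_vandermonde K ?n b' *
          det (mat ?n ?n (\<lambda>(i, j). exp (b' j * x (Suc i)) / b' j - exp (b' j * x i) / b' j)))"
    using ratio[of b] nb unfolding b'_def a0 by simp
  ultimately show ?case
    by (simp add: mult.left_commute)
qed

section \<open>Varying one or two exponents\<close>

lemma partial_vandermonde_eq: "partial_vandermonde N N a = vandermonde_prod N a"
proof (induction N)
  case 0
  show ?case by (simp add: partial_vandermonde_def vandermonde_prod_def)
next
  case (Suc N)
  have "(\<Prod>i<N. \<Prod>j\<in>{i<..<Suc N}. a j - a i) = (\<Prod>i<N. (a N - a i) * (\<Prod>j\<in>{i<..<N}. a j - a i))"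
  proof (rule prod.cong)
    fix i assume "i \<in> {..<N}"
    hence "{i<..<Suc N} = insert N {i<..<N}" by auto
    thus "(\<Prod>j\<in>{i<..<Suc N}. a j - a i) = (a N - a i) * (\<Prod>j\<in>{i<..<N}. a j - a i)" by simp
  qed simp
  moreover have "{N<..<Suc N} = {}" by auto
  ultimately show ?case
    using Suc.IH by (simp add: partial_vandermonde_def vandermonde_prod_def prod.distrib)
qed

lemma partial_vandermonde_1: "partial_vandermonde K (K + 1) a = vandermonde_prod (K + 1) a"
proof -
  have "{K<..<Suc K} = {}" by auto
  thus ?thesis
    unfolding partial_vandermonde_eq[symmetric] by (simp add: partial_vandermonde_def)
qed

lemma partial_vandermonde_2:
  "vandermonde_prod (K + 2) a = (a (K + 1) - a K) * partial_vandermonde K (K + 2) a"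
proof -
  have "{K<..<Suc (Suc K)} = {Suc K}" "{Suc K<..<Suc (Suc K)} = {}" by auto
  thus ?thesis
    unfolding partial_vandermonde_eq[symmetric]
    by (simp add: partial_vandermonde_def eval_nat_numeral)
qed

lemma exp_det_0: "exp_det 0 x a = 1"
  by (simp add: exp_det_def)

lemma exp_det_1: "exp_det 1 x a = exp (a 0 * x 0)"
  unfolding exp_det_def by (subst det_single) auto

text \<open>Written in terms of the midpoint and half the difference of the two exponents: when they move
  apart about a fixed midpoint, only the argument of \<open>sinh\<close> changes.\<close>
lemma exp_det_2:
  "exp_det 2 x a = exp ((a 0 + a 1) / 2 * (x 0 + x 1)) * (2 * sinh ((a 1 - a 0) / 2 * (x 1 - x 0)))"
proof -
  have "exp_det 2 x a = exp (a 0 * x 0) * exp (a 1 * x 1) - exp (a 1 * x 0) * exp (a 0 * x 1)"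
    unfolding exp_det_def
    by (subst laplace_expansion_row[of _ 2 0])
       (simp_all add: cofactor_def eval_nat_numeral mat_delete_def det_single)
  moreover have "a 0 * x 0 + a 1 * x 1 = (a 0 + a 1) / 2 * (x 0 + x 1) + (a 1 - a 0) / 2 * (x 1 - x 0)"
    "a 1 * x 0 + a 0 * x 1 = (a 0 + a 1) / 2 * (x 0 + x 1) + - ((a 1 - a 0) / 2 * (x 1 - x 0))"
    by (simp_all add: field_simps)
  ultimately show ?thesis
    by (simp only: exp_add[symmetric])
       (simp only: exp_add sinh_field_def, simp add: field_simps)
qed

lemma sinh_ratio_mono:
  fixes s t d :: real
  assumes "0 < s" "s \<le> t" "0 \<le> d"
  shows "sinh (s * d) / s \<le> sinh (t * d) / t"
proof -
  define h where "h d = sinh (t * d) / t - sinh (s * d) / s" for d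
  have "h 0 \<le> h d"
  proof (rule DERIV_nonneg_imp_nondecreasing[where f = h])
    fix z assume z: "0 \<le> z" "z \<le> d"
    have "(h has_real_derivative cosh (t * z) - cosh (s * z)) (at z)"
      unfolding h_def using assms by (auto intro!: derivative_eq_intros)
    moreover have "cosh (s * z) \<le> cosh (t * z)"
      using assms z by (subst cosh_real_nonneg_le_iff) (auto intro: mult_right_mono)
    ultimately show "\<exists>v. (h has_real_derivative v) (at z) \<and> 0 \<le> v" by (intro exI[of _ "cosh (t * z) - cosh (s * z)"]) simp
  qed fact
  thus ?thesis by (simp add: h_def)
qed

text \<open>Total positivity of the exponential kernel: all exponents are shared, and the comparison starts
  from \<open>0 \<le> 1\<close> for the empty determinant.\<close>
lemma exp_det_ratio_nonneg:
  assumes "inj_on a {..<N}" "mono_on {..<N} x" "\<forall>i<N. 0 \<le> x i"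
  shows "0 \<le> exp_det N x a / vandermonde_prod N a"
  using exp_det_compare[of a N 0 a 0 1 x] assms
  by (simp add: exp_det_0 partial_vandermonde_eq)

text \<open>With one exponent left over, the comparison starts from the fact that \<open>exp (a * y)\<close> increases in
  \<open>a\<close> for nonnegative points \<open>y\<close>.\<close>
lemma exp_det_ratio_raise_last:
  assumes "inj_on a {..<K + 1}" "inj_on b {..<K + 1}"
      and "\<And>k. k < K \<Longrightarrow> a k = b k" "a K \<le> b K"
      and "mono_on {..<K + 1} x" "\<forall>i<K + 1. 0 \<le> x i"
  shows "exp_det (K + 1) x a / vandermonde_prod (K + 1) a
       \<le> exp_det (K + 1) x b / vandermonde_prod (K + 1) b"
proof -
  have "1 * (exp_det (K + 1) x a / partial_vandermonde K (K + 1) a)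
       \<le> 1 * (exp_det (K + 1) x b / partial_vandermonde K (K + 1) b)"
  proof (rule exp_det_compare)
    fix y :: "nat \<Rightarrow> real" assume "\<forall>i<1. 0 \<le> y i"
    thus "1 * exp_det 1 y (\<lambda>j. a (K + j)) \<le> 1 * exp_det 1 y (\<lambda>j. b (K + j))"
      using assms(4) by (simp add: exp_det_1 mult_right_mono del: One_nat_def)
  qed (use assms in auto)
  thus ?thesis by (simp only: partial_vandermonde_1 mult_1)
qed

text \<open>With two exponents left over, at distance \<open>2 * s\<close>, the comparison starts from the fact that
  \<open>sinh (s * d) / s\<close> increases in \<open>s\<close>; the denominator is the Vandermonde factor of the pair.\<close>
lemma exp_det_ratio_spread_last:
  assumes "inj_on a {..<K + 2}" "inj_on b {..<K + 2}"
      and "\<And>k. k < K \<Longrightarrow> a k = b k" "a K < a (K + 1)"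
      and "b K = a K - e" "b (K + 1) = a (K + 1) + e" "0 \<le> e"
      and "mono_on {..<K + 2} x" "\<forall>i<K + 2. 0 \<le> x i"
  shows "exp_det (K + 2) x a / vandermonde_prod (K + 2) a
       \<le> exp_det (K + 2) x b / vandermonde_prod (K + 2) b"
proof -
  have "1 / (a (K + 1) - a K) * (exp_det (K + 2) x a / partial_vandermonde K (K + 2) a)
      \<le> 1 / (b (K + 1) - b K) * (exp_det (K + 2) x b / partial_vandermonde K (K + 2) b)"
  proof (rule exp_det_compare)
    fix y :: "nat \<Rightarrow> real" assume y: "mono_on {..<2} y" "\<forall>i<2. 0 \<le> y i"
    define s where "s = (a (K + 1) - a K) / 2"
    have s: "0 < s" "a (K + 1) - a K = 2 * s" using assms(4) by (simp_all add: s_def)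
    have d: "b (K + 1) - b K = 2 * (s + e)" "b K + b (K + 1) = a K + a (K + 1)"
      using assms(5,6) s by simp_all
    have "y 0 \<le> y 1" using y(1) by (auto simp: mono_on_def)
    hence "sinh (s * (y 1 - y 0)) / s \<le> sinh ((s + e) * (y 1 - y 0)) / (s + e)"
      using s assms(7) by (intro sinh_ratio_mono) auto
    hence "exp ((a K + a (K + 1)) / 2 * (y 0 + y 1)) * (sinh (s * (y 1 - y 0)) / s)
         \<le> exp ((a K + a (K + 1)) / 2 * (y 0 + y 1)) * (sinh ((s + e) * (y 1 - y 0)) / (s + e))"
      by (intro mult_left_mono) auto
    thus "1 / (a (K + 1) - a K) * exp_det 2 y (\<lambda>j. a (K + j))
        \<le> 1 / (b (K + 1) - b K) * exp_det 2 y (\<lambda>j. b (K + j))"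
      unfolding exp_det_2 add_0_right d s(2) by (simp del: distrib_left_numeral)
  qed (use assms in auto)
  thus ?thesis by (simp only: partial_vandermonde_2) simp
qed

section \<open>Symmetry in the exponents and in the points\<close>

definition vandermonde_ratio :: "nat \<Rightarrow> (nat \<Rightarrow> real) \<Rightarrow> (nat \<Rightarrow> real) \<Rightarrow> real" where
  "vandermonde_ratio N x a = \<bar>exp_det N x a\<bar> / \<bar>vandermonde_prod N a\<bar>"

lemma exp_det_cong:
  "(\<And>i. i < N \<Longrightarrow> x i = y i) \<Longrightarrow> (\<And>j. j < N \<Longrightarrow> a j = b j) \<Longrightarrow> exp_det N x a = exp_det N y b"
  unfolding exp_det_def by (intro arg_cong[where f = det] eq_matI) auto

lemma vandermonde_prod_cong:
  "(\<And>j. j < N \<Longrightarrow> a j = b j) \<Longrightarrow> vandermonde_prod N a = vandermonde_prod N b"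
  unfolding vandermonde_prod_def by (intro prod.cong) auto

lemma vandermonde_ratio_cong:
  "(\<And>i. i < N \<Longrightarrow> x i = y i) \<Longrightarrow> (\<And>j. j < N \<Longrightarrow> a j = b j) \<Longrightarrow>
   vandermonde_ratio N x a = vandermonde_ratio N y b"
  unfolding vandermonde_ratio_def
  by (metis exp_det_cong vandermonde_prod_cong)

lemma abs_signof_mult: "\<bar>signof p * (c :: real)\<bar> = \<bar>c\<bar>"
  by (simp add: sign_def abs_mult)

lemma abs_exp_det_permute_rows:
  assumes "p permutes {..<N}"
  shows "\<bar>exp_det N (x \<circ> p) a\<bar> = \<bar>exp_det N x a\<bar>"
proof -
  let ?A = "mat N N (\<lambda>(i, j). exp (a j * x i))"
  have "exp_det N (x \<circ> p) a = det (mat N N (\<lambda>(i, j). ?A $$ (p i, j)))"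
    unfolding exp_det_def using permutes_in_image[OF assms]
    by (intro arg_cong[where f = det] eq_matI) auto
  also have "\<dots> = signof p * det ?A"
    using assms by (intro det_permute_rows) (auto simp: lessThan_atLeast0)
  finally show ?thesis by (simp only: abs_signof_mult exp_det_def)
qed

lemma exp_det_swap: "exp_det N a x = exp_det N x a"
proof -
  have "exp_det N a x = det (transpose_mat (mat N N (\<lambda>(i, j). exp (a j * x i))))"
    unfolding exp_det_def by (intro arg_cong[where f = det] eq_matI) (auto simp: mult.commute)
  also have "\<dots> = exp_det N x a"
    unfolding exp_det_def by (rule det_transpose) auto
  finally show ?thesis .
qed

text \<open>The product over ordered pairs is visibly symmetric, and it is the square of the Vandermonde
  product. So the latter is symmetric up to sign.\<close>
lemma vandermonde_prod_square:
  "(\<Prod>i<N. \<Prod>j<N. if i = j then 1 else \<bar>t j - t i\<bar>) = (vandermonde_prod N t)\<^sup>2"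
proof (induction N)
  case 0
  show ?case by (simp add: vandermonde_prod_def)
next
  case (Suc N)
  have "(\<Prod>j<N. if N = j then 1 else \<bar>t j - t N\<bar>) = (\<Prod>j<N. \<bar>t N - t j\<bar>)"
    by (intro prod.cong) auto
  moreover have "(\<Prod>i<N. if i = N then 1 else \<bar>t N - t i\<bar>) = (\<Prod>i<N. \<bar>t N - t i\<bar>)"
    by (intro prod.cong) auto
  moreover have "(\<Prod>i<N. \<bar>t N - t i\<bar>) * (\<Prod>i<N. \<bar>t N - t i\<bar>) = (\<Prod>i<N. t N - t i)\<^sup>2"
    by (simp add: power2_eq_square abs_prod[symmetric])
  ultimately show ?case
    using Suc.IH by (simp add: prod.distrib vandermonde_prod_def power_mult_distrib mult.assoc)
qed

lemma abs_vandermonde_prod_permute: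
  assumes p: "p permutes {..<N}"
  shows "\<bar>vandermonde_prod N (t \<circ> p)\<bar> = \<bar>vandermonde_prod N t\<bar>"
proof -
  let ?g = "\<lambda>i j. if i = j then 1 else \<bar>t j - t i\<bar>"
  have "(vandermonde_prod N (t \<circ> p))\<^sup>2 = (\<Prod>i<N. \<Prod>j<N. ?g (p i) (p j))"
    unfolding vandermonde_prod_square[symmetric] using permutes_inj[OF p]
    by (intro prod.cong) (auto simp: inj_eq)
  also have "\<dots> = (\<Prod>i<N. \<Prod>j<N. ?g (p i) j)"
  proof (rule prod.cong)
    fix i
    show "(\<Prod>j<N. ?g (p i) (p j)) = (\<Prod>j<N. ?g (p i) j)"
      using prod.permute[OF p, of "?g (p i)"] unfolding o_def by simp
  qed simp
  also have "\<dots> = (\<Prod>i<N. \<Prod>j<N. ?g i j)"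
    using prod.permute[OF p, of "\<lambda>i. \<Prod>j<N. ?g i j"] by (simp add: o_def)
  finally show ?thesis
    unfolding vandermonde_prod_square by (simp add: abs_eq_iff power2_eq_iff)
qed

lemma vandermonde_ratio_permute:
  "p permutes {..<N} \<Longrightarrow> vandermonde_ratio N x (a \<circ> p) = vandermonde_ratio N x a"
  "p permutes {..<N} \<Longrightarrow> vandermonde_ratio N (x \<circ> p) a = vandermonde_ratio N x a"
  unfolding vandermonde_ratio_def
  using abs_exp_det_permute_rows[of p N a x] abs_exp_det_permute_rows[of p N x a]
  by (simp_all add: exp_det_swap[of N x] exp_det_swap[of N "x \<circ> p"] abs_vandermonde_prod_permute)

text \<open>The comparisons with signs pass to absolute values because the smaller side is nonnegative.\<close>
lemma vandermonde_ratio_le: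
  assumes "0 \<le> exp_det N x a / vandermonde_prod N a"
      and "exp_det N x a / vandermonde_prod N a \<le> exp_det N x b / vandermonde_prod N b"
  shows "vandermonde_ratio N x a \<le> vandermonde_ratio N x b"
  using assms by (simp add: vandermonde_ratio_def flip: abs_divide)

lemma vandermonde_ratio_raise:
  assumes x: "mono_on {..<N} x" "\<forall>i<N. 0 \<le> x i"
      and a: "inj_on a {..<N}" "inj_on (a(k := a k + e)) {..<N}"
      and k: "k < N" and e: "0 \<le> e"
  shows "vandermonde_ratio N x a \<le> vandermonde_ratio N x (a(k := a k + e))"
proof -
  obtain K where N: "N = K + 1" using k by (cases N) auto
  \<comment> \<open>By symmetry, the exponent that is raised may be put last.\<close>
  define p where "p = transpose k K"
  have p: "p permutes {..<N}" unfolding p_def N using k N by (intro permutes_swap_id) auto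
  have inj: "inj_on (b \<circ> p) {..<N}" if "inj_on b {..<N}" for b :: "nat \<Rightarrow> real"
    using that p by (intro comp_inj_on) (auto simp: permutes_image permutes_inj_on)
  have "vandermonde_ratio N x (a \<circ> p) \<le> vandermonde_ratio N x (a(k := a k + e) \<circ> p)"
  proof (rule vandermonde_ratio_le)
    show "0 \<le> exp_det N x (a \<circ> p) / vandermonde_prod N (a \<circ> p)"
      by (intro exp_det_ratio_nonneg inj a x)
    have "(a \<circ> p) j = (a(k := a k + e) \<circ> p) j" if "j < K" for j
      using that by (auto simp: p_def transpose_def)
    thus "exp_det N x (a \<circ> p) / vandermonde_prod N (a \<circ> p)
        \<le> exp_det N x (a(k := a k + e) \<circ> p) / vandermonde_prod N (a(k := a k + e) \<circ> p)"
      using inj[OF a(1)] inj[OF a(2)] x e unfolding N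
      by (intro exp_det_ratio_raise_last) (auto simp: p_def)
  qed
  thus ?thesis by (simp only: vandermonde_ratio_permute[OF p])
qed

lemma vandermonde_ratio_spread:
  assumes x: "mono_on {..<N} x" "\<forall>i<N. 0 \<le> x i"
      and a: "inj_on a {..<N}" "inj_on (a(i := a i + e, j := a j - e)) {..<N}"
      and ij: "i < N" "j < N" "a j < a i" and e: "0 \<le> e"
  shows "vandermonde_ratio N x a \<le> vandermonde_ratio N x (a(i := a i + e, j := a j - e))"
proof -
  have "i \<noteq> j" using ij by auto
  hence "2 \<le> N" using ij by arith
  then obtain K where N: "N = K + 2" by (metis le_add_diff_inverse2)
  \<comment> \<open>By symmetry, the exponents \<open>j\<close> and \<open>i\<close> may be put last, in this order.\<close>
  define q where "q = transpose i (K + 1)"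
  define p where "p = q \<circ> transpose (q j) K"
  have q: "q permutes {..<N}" unfolding q_def N using ij N by (intro permutes_swap_id) auto
  have qj: "q j < N" using permutes_in_image[OF q] ij by auto
  have qj': "q j \<noteq> K + 1" using \<open>i \<noteq> j\<close> by (auto simp: q_def transpose_def)
  have p: "p permutes {..<N}" unfolding p_def
    using qj N by (intro permutes_compose[OF permutes_swap_id q]) auto
  have qq: "q (q l) = l" for l by (simp add: q_def)
  have pK: "p K = j" by (simp add: p_def qq)
  have pK1: "p (K + 1) = i" using qj' by (simp add: p_def transpose_def q_def)
  have inj: "inj_on (b \<circ> p) {..<N}" if "inj_on b {..<N}" for b :: "nat \<Rightarrow> real"
    using that p by (intro comp_inj_on) (auto simp: permutes_image permutes_inj_on)
  let ?b = "a(i := a i + e, j := a j - e)"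
  have "vandermonde_ratio N x (a \<circ> p) \<le> vandermonde_ratio N x (?b \<circ> p)"
  proof (rule vandermonde_ratio_le)
    show "0 \<le> exp_det N x (a \<circ> p) / vandermonde_prod N (a \<circ> p)"
      by (intro exp_det_ratio_nonneg inj a x)
    have "(a \<circ> p) l = (?b \<circ> p) l" if "l < K" for l
    proof -
      have "p l \<noteq> p K" "p l \<noteq> p (K + 1)" using that permutes_inj[OF p] by (auto simp: inj_eq)
      thus ?thesis unfolding pK pK1 by simp
    qed
    thus "exp_det N x (a \<circ> p) / vandermonde_prod N (a \<circ> p)
        \<le> exp_det N x (?b \<circ> p) / vandermonde_prod N (?b \<circ> p)"
      using inj[OF a(1)] inj[OF a(2)] x e ij \<open>i \<noteq> j\<close> pK pK1 unfolding N
      by (intro exp_det_ratio_spread_last[where e = e]) auto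
  qed
  thus ?thesis by (simp only: vandermonde_ratio_permute[OF p])
qed

section \<open>From majorization to the inequality\<close>

text \<open>Abel summation writes the displacement with partial sums \<open>S\<close> as a nonnegative combination of
  transfers from one exponent to the preceding larger one and of one increase of the smallest
  exponent. Each of these moves increases the ratio as long as the exponents stay distinct. If the
  partial sums are below half the gap between exponents, no two exponents meet on the way, since
  each exponent is displaced by less than half the gap.\<close>
lemma vandermonde_ratio_local_step:
  assumes x: "mono_on {..<N} x" "\<forall>i<N. 0 \<le> x i"
      and gap: "\<And>i j. i < j \<Longrightarrow> j < N \<Longrightarrow> b j + \<delta> \<le> b i"
      and S: "S 0 = 0" "\<And>k. k \<le> N \<Longrightarrow> 0 \<le> S k" "\<And>k. k \<le> N \<Longrightarrow> 2 * S k < \<delta>"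
  shows "vandermonde_ratio N x b \<le> vandermonde_ratio N x (\<lambda>j. b j + (S (Suc j) - S j))"
proof -
  \<comment> \<open>The tuple after \<open>r\<close> moves: move number \<open>r\<close> adds \<open>S (Suc r)\<close> to entry \<open>r\<close> and takes it from
    entry \<open>Suc r\<close>, if there is one.\<close>
  define z where "z r j = b j + (if j < r then S (Suc j) else 0) - (if j \<le> r then S j else 0)" for r j
  have decr: "z r j < z r i" if "i < j" "j < N" for r i j
    using gap[OF that] that S(2)[of i] S(2)[of j] S(2)[of "Suc i"] S(2)[of "Suc j"]
      S(3)[of i] S(3)[of j] S(3)[of "Suc i"] S(3)[of "Suc j"] by (auto simp: z_def)
  have inj: "inj_on (z r) {..<N}" for r
    by (intro inj_onI) (metis decr lessThan_iff linorder_neqE_nat less_irrefl)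
  have step: "vandermonde_ratio N x (z r) \<le> vandermonde_ratio N x (z (Suc r))" if r: "r < N" for r
  proof (cases "Suc r < N")
    case True
    have eq: "z (Suc r) = (z r)(r := z r r + S (Suc r), Suc r := z r (Suc r) - S (Suc r))"
      by (auto simp: z_def fun_eq_iff)
    show ?thesis
      unfolding eq
      by (rule vandermonde_ratio_spread[OF x inj inj[of "Suc r", unfolded eq] r True])
         (use decr[of r "Suc r" r] True S(2)[of "Suc r"] in auto)
  next
    case False
    have eq: "z (Suc r) j = ((z r)(r := z r r + S (Suc r))) j" if "j < N" for j
      using that False by (auto simp: z_def)
    have "inj_on ((z r)(r := z r r + S (Suc r))) {..<N}"
      using inj[of "Suc r"] eq by (auto simp: inj_on_def)
    hence "vandermonde_ratio N x (z r) \<le> vandermonde_ratio N x ((z r)(r := z r r + S (Suc r)))"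
      using r S(2)[of "Suc r"] by (intro vandermonde_ratio_raise[OF x inj]) auto
    also have "\<dots> = vandermonde_ratio N x (z (Suc r))"
      by (rule vandermonde_ratio_cong) (simp_all only: eq)
    finally show ?thesis .
  qed
  have "vandermonde_ratio N x (z 0) \<le> vandermonde_ratio N x (z r)" if "r \<le> N" for r
    using that by (induction r) (use step in \<open>auto intro: order_trans simp: Suc_le_eq\<close>)
  moreover have "vandermonde_ratio N x (z 0) = vandermonde_ratio N x b"
    by (rule vandermonde_ratio_cong) (auto simp: z_def S)
  moreover have "vandermonde_ratio N x (z N) = vandermonde_ratio N x (\<lambda>j. b j + (S (Suc j) - S j))"
    by (rule vandermonde_ratio_cong) (auto simp: z_def)
  ultimately show ?thesis by fastforce
qed

lemma ex_uniform_gap: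
  fixes a :: "nat \<Rightarrow> real"
  assumes "\<And>i j. i < j \<Longrightarrow> j < N \<Longrightarrow> a j < a i"
  shows "\<exists>\<delta>>0. \<forall>i j. i < j \<longrightarrow> j < N \<longrightarrow> a j + \<delta> \<le> a i"
proof -
  let ?D = "insert 1 ((\<lambda>(i, j). a i - a j) ` {(i, j). i < j \<and> j < N})"
  have "{(i, j). i < j \<and> j < N} \<subseteq> {..<N} \<times> {..<N}" by auto
  hence fin: "finite ?D" by (intro finite.insertI finite_imageI finite_subset[OF _ finite_SigmaI]) auto
  have "Min ?D \<in> ?D" using fin by (intro Min_in) auto
  hence "0 < Min ?D" using assms by auto
  moreover have "Min ?D \<le> a i - a j" if "i < j" "j < N" for i j
    using that fin by (intro Min_le) auto
  ultimately show ?thesis by (intro exI[of _ "Min ?D"]) (force simp: algebra_simps)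
qed

text \<open>Along the straight segment from \<open>b\<close> to \<open>a\<close> the exponents stay strictly decreasing, with a gap
  that is bounded below. So the segment can be cut into pieces that are short enough for the local
  step. Walking along the segment avoids coinciding exponents, at which the Vandermonde product
  vanishes.\<close>
lemma vandermonde_ratio_mono_majorize:
  assumes x: "mono_on {..<N} x" "\<forall>i<N. 0 \<le> x i"
      and a: "\<And>i j. i < j \<Longrightarrow> j < N \<Longrightarrow> a j < a i"
      and b: "\<And>i j. i < j \<Longrightarrow> j < N \<Longrightarrow> b j < b i"
      and maj: "\<And>k. k \<le> N \<Longrightarrow> (\<Sum>j<k. b j) \<le> (\<Sum>j<k. a j)"
  shows "vandermonde_ratio N x b \<le> vandermonde_ratio N x a"
proof -
  define S where "S k = (\<Sum>j<k. a j - b j)" for k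
  have S: "0 \<le> S k" if "k \<le> N" for k using maj[OF that] by (simp add: S_def sum_subtractf)
  have "\<exists>\<delta>>0. \<forall>i j. i < j \<longrightarrow> j < N \<longrightarrow> a j + \<delta> \<le> a i"
    by (rule ex_uniform_gap) (rule a)
  then obtain \<delta>1 where \<delta>1: "0 < \<delta>1" "\<And>i j. i < j \<Longrightarrow> j < N \<Longrightarrow> a j + \<delta>1 \<le> a i"
    by blast
  have "\<exists>\<delta>>0. \<forall>i j. i < j \<longrightarrow> j < N \<longrightarrow> b j + \<delta> \<le> b i"
    by (rule ex_uniform_gap) (rule b)
  then obtain \<delta>2 where \<delta>2: "0 < \<delta>2" "\<And>i j. i < j \<Longrightarrow> j < N \<Longrightarrow> b j + \<delta>2 \<le> b i"
    by blast
  define \<delta> where "\<delta> = min \<delta>1 \<delta>2"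
  have \<delta>: "0 < \<delta>" using \<delta>1 \<delta>2 by (simp add: \<delta>_def)
  obtain L :: nat where L: "2 * (\<Sum>k\<le>N. S k) / \<delta> < real L" using reals_Archimedean2 by blast
  have "0 \<le> (\<Sum>k\<le>N. S k)" by (intro sum_nonneg) (auto intro: S)
  hence "0 \<le> 2 * (\<Sum>k\<le>N. S k) / \<delta>" using \<delta> by simp
  hence L0: "0 < real L" using L by linarith
  have small: "2 * (S k / L) < \<delta>" if "k \<le> N" for k
  proof -
    have "S k \<le> (\<Sum>k\<le>N. S k)" using that by (intro member_le_sum) (auto intro: S)
    thus ?thesis using L L0 \<delta> by (simp add: field_simps)
  qed
  define p where "p s j = b j + s * (a j - b j)" for s :: real and j
  have gap: "p s j + \<delta> \<le> p s i" if "i < j" "j < N" "0 \<le> s" "s \<le> 1" for s i j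
  proof -
    have "(1 - s) * (b j + \<delta>) + s * (a j + \<delta>) \<le> (1 - s) * b i + s * a i"
      using \<delta>1(2)[OF that(1,2)] \<delta>2(2)[OF that(1,2)] that(3,4)
      by (intro add_mono mult_left_mono) (auto simp: \<delta>_def)
    thus ?thesis by (simp add: p_def algebra_simps)
  qed
  have "vandermonde_ratio N x (p 0) \<le> vandermonde_ratio N x (p (q / L))" if "q \<le> L" for q :: nat
    using that
  proof (induction q)
    case (Suc q)
    let ?s = "real q / L"
    have s: "0 \<le> ?s" "?s \<le> 1" using Suc.prems L0 by auto
    have "vandermonde_ratio N x (p ?s)
        \<le> vandermonde_ratio N x (\<lambda>j. p ?s j + (S (Suc j) / L - S j / L))"
    proof (rule vandermonde_ratio_local_step[OF x])
      fix i j assume "i < j" "j < N"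
      thus "p ?s j + \<delta> \<le> p ?s i" by (rule gap[OF _ _ s])
    qed (use S small L0 in \<open>auto simp: S_def\<close>)
    also have "(\<lambda>j. p ?s j + (S (Suc j) / L - S j / L)) = p (Suc q / L)"
      by (simp add: p_def S_def fun_eq_iff add_divide_distrib diff_divide_distrib algebra_simps)
    finally show ?case using Suc by simp
  qed simp
  from this[of L] L0 have "vandermonde_ratio N x (p 0) \<le> vandermonde_ratio N x (p 1)" by simp
  moreover have "p 0 = b" "p 1 = a" by (simp_all add: p_def fun_eq_iff)
  ultimately show ?thesis by simp
qed

section \<open>From the inequality to majorization\<close>

lemma permutes_inversion:
  assumes q: "q permutes {..<N}" "q \<noteq> id"
  obtains i j where "i < j" "j < N" "q j < (q i :: nat)"
proof -
  define i where "i = (LEAST i. q i \<noteq> i)"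
  have ex: "\<exists>i. q i \<noteq> i" using q(2) by (auto simp: fun_eq_iff)
  have i: "q i \<noteq> i" unfolding i_def by (rule LeastI_ex[OF ex])
  have below: "q k = k" if "k < i" for k using not_less_Least[of k "\<lambda>i. q i \<noteq> i"] that by (auto simp: i_def)
  obtain j where j: "q j = i" using permutes_surj[OF q(1)] by (metis surjD)
  have "i < N" using i q(1) by (auto simp: permutes_def)
  hence "j < N" using permutes_in_image[OF q(1), of j] j by simp
  moreover have "i < j" using below[of j] j i by (metis linorder_neqE_nat)
  moreover have "\<not> q i < i"
    using below[of "q i"] i permutes_inj[OF q(1)] by (auto simp: inj_eq)
  hence "q j < q i" using i j by simp
  ultimately show ?thesis using that by blast
qed

text \<open>Undoing an inversion strictly increases the sum. So a permutation that maximizes it can only be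
  the identity.\<close>
lemma rearrangement_strict:
  fixes y a :: "nat \<Rightarrow> real"
  assumes y: "\<And>i j. i < j \<Longrightarrow> j < N \<Longrightarrow> y j < y i"
      and a: "\<And>i j. i < j \<Longrightarrow> j < N \<Longrightarrow> a j < a i"
      and p: "p permutes {..<N}" "p \<noteq> id"
  shows "(\<Sum>i<N. y i * a (p i)) < (\<Sum>i<N. y i * a i)"
proof -
  define f where "f p = (\<Sum>i<N. y i * a (p i))" for p
  let ?P = "{p. p permutes {..<N}}"
  have improve: "\<exists>q'. q' permutes {..<N} \<and> f q < f q'" if q: "q permutes {..<N}" "q \<noteq> id" for q
  proof -
    obtain i j where ij: "i < j" "j < N" "q j < q i"
      by (rule permutes_inversion[OF q])
    have iN: "i < N" using ij by simp
    define q' where "q' = q \<circ> transpose i j"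
    have q': "q' permutes {..<N}"
      unfolding q'_def using ij iN by (intro permutes_compose[OF permutes_swap_id q(1)]) auto
    have split: "sum g {..<N} = g i + (g j + sum g ({..<N} - {i} - {j}))" for g :: "nat \<Rightarrow> real"
      using ij iN by (subst sum.remove[of _ i], simp, simp, subst sum.remove[of _ j]) auto
    have "(\<Sum>l\<in>{..<N} - {i} - {j}. y l * a (q' l)) = (\<Sum>l\<in>{..<N} - {i} - {j}. y l * a (q l))"
      by (intro sum.cong) (auto simp: q'_def transpose_def)
    hence "f q' - f q = (y i - y j) * (a (q j) - a (q i))"
      using ij by (simp add: f_def split q'_def algebra_simps)
    moreover have "q i < N" using permutes_in_image[OF q(1), of i] iN by simp
    hence "0 < (y i - y j) * (a (q j) - a (q i))"
      using y[OF ij(1,2)] a[OF ij(3)] by simp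
    ultimately show ?thesis using q' by (intro exI[of _ q']) simp
  qed
  have fin: "finite ?P" by (simp add: finite_permutations)
  have ne: "?P \<noteq> {}" using permutes_id by blast
  obtain q where q: "q permutes {..<N}" "\<And>p. p permutes {..<N} \<Longrightarrow> f p \<le> f q"
    using Max_in[of "f ` ?P"] Max_ge[of "f ` ?P"] fin ne by fastforce
  have "q = id" using improve[OF q(1)] q(2) by (meson leD)
  moreover obtain p' where "p' permutes {..<N}" "f p < f p'" using improve[OF p] by blast
  ultimately have "f p < f id" using q(2)[of p'] by simp
  thus ?thesis by (simp add: f_def)
qed

text \<open>In the Leibniz expansion each permutation contributes one exponential in \<open>T\<close>. By the strict
  rearrangement inequality the identity has the largest rate, so it dominates, with
  coefficient 1.\<close>
lemma exp_det_asymptotics: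
  assumes y: "\<And>i j. i < j \<Longrightarrow> j < N \<Longrightarrow> y j < y i"
      and a: "\<And>i j. i < j \<Longrightarrow> j < N \<Longrightarrow> a j < a i"
  shows "((\<lambda>T. exp_det N (\<lambda>i. T * y i) a * exp (- T * (\<Sum>i<N. y i * a i))) \<longlongrightarrow> 1) at_top"
proof -
  let ?P = "{p. p permutes {..<N}}"
  define f where "f p = (\<Sum>i<N. y i * a (p i))" for p
  have eq: "exp_det N (\<lambda>i. T * y i) a * exp (- T * f id) = (\<Sum>p\<in>?P. signof p * exp (T * (f p - f id)))" for T
  proof -
    have "exp_det N (\<lambda>i. T * y i) a = (\<Sum>p\<in>?P. signof p * (\<Prod>i<N. exp (a (p i) * (T * y i))))"
      unfolding exp_det_def lessThan_atLeast0
      by (subst det_def'[of _ N]) (auto intro!: sum.cong prod.cong simp: permutes_in_image)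
    also have "\<dots> = (\<Sum>p\<in>?P. signof p * exp (T * f p))"
      by (simp add: exp_sum[symmetric] f_def sum_distrib_left mult_ac)
    finally show ?thesis
      by (simp add: sum_distrib_right mult.assoc exp_add[symmetric] right_diff_distrib)
  qed
  have "((\<lambda>T. \<Sum>p\<in>?P. signof p * exp (T * (f p - f id))) \<longlongrightarrow> (\<Sum>p\<in>?P. if p = id then 1 else 0 :: real)) at_top"
  proof (rule tendsto_sum)
    fix p assume p: "p \<in> ?P"
    show "((\<lambda>T. signof p * exp (T * (f p - f id))) \<longlongrightarrow> (if p = id then 1 else 0 :: real)) at_top"
    proof (cases "p = id")
      case False
      have "f p - f id < 0"
        using rearrangement_strict[of N y a p] y a p False by (simp add: f_def)
      hence "filterlim (\<lambda>T. T * (f p - f id)) at_bot at_top"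
        by (subst mult.commute, intro filterlim_tendsto_neg_mult_at_bot[OF tendsto_const _ filterlim_ident])
      hence "((\<lambda>T. exp (T * (f p - f id))) \<longlongrightarrow> 0) at_top"
        by (rule filterlim_compose[OF exp_at_bot])
      hence "((\<lambda>T. signof p * exp (T * (f p - f id))) \<longlongrightarrow> signof p * 0) at_top"
        by (rule tendsto_mult_left)
      thus ?thesis using False by simp
    qed simp
  qed
  moreover have "(\<Sum>p\<in>?P. if p = id then 1 else 0 :: real) = 1"
    by (subst sum.delta) (auto simp: finite_permutations permutes_id)
  ultimately have "((\<lambda>T. exp_det N (\<lambda>i. T * y i) a * exp (- T * f id)) \<longlongrightarrow> 1) at_top"
    unfolding eq by simp
  thus ?thesis by (simp add: f_def)
qed

lemma vandermonde_prod_nonzero: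
  assumes "inj_on a {..<N}"
  shows "vandermonde_prod N a \<noteq> 0"
  unfolding vandermonde_prod_def using inj_onD[OF assms] by fastforce

lemma inj_on_of_decreasing:
  fixes a :: "nat \<Rightarrow> real"
  assumes "\<And>i j. i < j \<Longrightarrow> j < N \<Longrightarrow> a j < a i"
  shows "inj_on a {..<N}"
  by (intro inj_onI) (metis assms lessThan_iff linorder_neqE_nat less_irrefl)

text \<open>Along the ray through \<open>y\<close> the ratios behave like exponentials with the two weighted
  sums as rates. So the rates must be ordered as the ratios are.\<close>
lemma weighted_sum_le_of_vandermonde_ratio_le:
  assumes y: "\<And>i j. i < j \<Longrightarrow> j < N \<Longrightarrow> y j < y i" "\<And>i. i < N \<Longrightarrow> 0 \<le> y i"
      and a: "\<And>i j. i < j \<Longrightarrow> j < N \<Longrightarrow> a j < a i"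
      and b: "\<And>i j. i < j \<Longrightarrow> j < N \<Longrightarrow> b j < b i"
      and le: "\<And>x. (\<forall>i<N. 0 \<le> x i) \<Longrightarrow> vandermonde_ratio N x b \<le> vandermonde_ratio N x a"
  shows "(\<Sum>i<N. y i * b i) \<le> (\<Sum>i<N. y i * a i)"
proof (rule ccontr)
  define A where "A = (\<Sum>i<N. y i * a i)"
  define B where "B = (\<Sum>i<N. y i * b i)"
  assume "\<not> ?thesis"
  hence less: "A - B < 0" by (simp add: A_def B_def)
  define D where "D c T = exp_det N (\<lambda>i. T * y i) c" for c T
  define Va where "Va = \<bar>vandermonde_prod N a\<bar>"
  define Vb where "Vb = \<bar>vandermonde_prod N b\<bar>"
  have Vb: "0 < Vb"
    using vandermonde_prod_nonzero[OF inj_on_of_decreasing[of N b]] b by (simp add: Vb_def)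
  have limb: "((\<lambda>T. \<bar>D b T * exp (- T * B)\<bar> / Vb) \<longlongrightarrow> \<bar>1\<bar> / Vb) at_top"
    unfolding D_def B_def divide_inverse
    by (intro tendsto_mult_right tendsto_rabs exp_det_asymptotics y b)
  have "filterlim (\<lambda>T. T * (A - B)) at_bot at_top"
    by (subst mult.commute, intro filterlim_tendsto_neg_mult_at_bot[OF tendsto_const less filterlim_ident])
  hence "((\<lambda>T. exp (T * (A - B))) \<longlongrightarrow> 0) at_top"
    by (rule filterlim_compose[OF exp_at_bot])
  moreover have "((\<lambda>T. \<bar>D a T * exp (- T * A)\<bar> / Va) \<longlongrightarrow> \<bar>1\<bar> / Va) at_top"
    unfolding D_def A_def divide_inverse
    by (intro tendsto_mult_right tendsto_rabs exp_det_asymptotics y a)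
  ultimately have lima: "((\<lambda>T. \<bar>D a T * exp (- T * A)\<bar> / Va * exp (T * (A - B))) \<longlongrightarrow> \<bar>1\<bar> / Va * 0) at_top"
    by (intro tendsto_mult)
  have "\<bar>1\<bar> / Vb \<le> \<bar>1\<bar> / Va * 0"
  proof (rule tendsto_le[OF _ lima limb])
    show "\<forall>\<^sub>F T in at_top. \<bar>D b T * exp (- T * B)\<bar> / Vb \<le> \<bar>D a T * exp (- T * A)\<bar> / Va * exp (T * (A - B))"
      using eventually_ge_at_top[of 0]
    proof eventually_elim
      case (elim T)
      have "\<bar>D b T\<bar> / Vb \<le> \<bar>D a T\<bar> / Va"
        using le[of "\<lambda>i. T * y i"] elim y(2) by (simp add: vandermonde_ratio_def D_def Va_def Vb_def)
      hence "\<bar>D b T\<bar> / Vb * exp (- T * B) \<le> \<bar>D a T\<bar> / Va * exp (- T * B)"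
        by (rule mult_right_mono) simp
      also have "exp (- T * B) = exp (- T * A) * exp (T * (A - B))"
        by (simp add: exp_add[symmetric] algebra_simps)
      finally show ?case by (simp add: abs_mult exp_add[symmetric] algebra_simps)
    qed
  qed simp
  thus False using Vb by simp
qed

text \<open>The weights should be the indicator of \<open>{..<k}\<close>, which is not strictly decreasing. They are
  perturbed by \<open>e * (N - i)\<close>, and \<open>e\<close> tends to 0.\<close>
lemma majorize_of_vandermonde_ratio_le:
  assumes a: "\<And>i j. i < j \<Longrightarrow> j < N \<Longrightarrow> a j < a i"
      and b: "\<And>i j. i < j \<Longrightarrow> j < N \<Longrightarrow> b j < b i"
      and le: "\<And>x. (\<forall>i<N. 0 \<le> x i) \<Longrightarrow> vandermonde_ratio N x b \<le> vandermonde_ratio N x a"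
      and k: "k \<le> N"
  shows "(\<Sum>i<k. b i) \<le> (\<Sum>i<k. a i)"
proof -
  have perturbed: "(\<Sum>i<k. c i) + e * (\<Sum>i<N. (real N - i) * c i)
      = (\<Sum>i<N. ((if i < k then 1 else 0) + e * (real N - i)) * c i)" for c e
  proof -
    have "{..<N} \<inter> {i. i < k} = {..<k}" using k by auto
    hence "(\<Sum>i<k. c i) = (\<Sum>i<N. (if i < k then 1 else 0) * c i)"
      by (simp add: sum.If_cases if_distrib[of "\<lambda>z. z * _"] cong: if_cong)
    thus ?thesis by (simp add: distrib_right sum.distrib sum_distrib_left mult.assoc)
  qed
  have "((\<lambda>e. (\<Sum>i<k. c i) + e * (\<Sum>i<N. (real N - i) * c i)) \<longlongrightarrow> (\<Sum>i<k. c i) + 0 * (\<Sum>i<N. (real N - i) * c i)) (at_right 0)" for c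
    by (intro tendsto_intros)
  note lim = this[of a] this[of b]
  have "(\<Sum>i<k. b i) + 0 * (\<Sum>i<N. (real N - i) * b i) \<le> (\<Sum>i<k. a i) + 0 * (\<Sum>i<N. (real N - i) * a i)"
  proof (rule tendsto_le[OF _ lim])
    show "\<forall>\<^sub>F e in at_right 0. (\<Sum>i<k. b i) + e * (\<Sum>i<N. (real N - i) * b i)
                              \<le> (\<Sum>i<k. a i) + e * (\<Sum>i<N. (real N - i) * a i)"
      using eventually_at_right_less[of 0]
    proof eventually_elim
      case (elim e)
      show ?case
        unfolding perturbed
        by (rule weighted_sum_le_of_vandermonde_ratio_le[OF _ _ a b le])
           (use elim in \<open>auto simp: add_le_less_mono add_less_le_mono\<close>)
    qed
  qed simp
  thus ?thesis by simp
qed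

section \<open>The equivalence\<close>

lemma permutes_of_mset_eq:
  assumes "mset xs = mset (map a [0..<N])"
  obtains p where "p permutes {..<N}" "\<And>i. i < N \<Longrightarrow> xs ! i = a (p i)"
proof -
  obtain p where p: "p permutes {..<length (map a [0..<N])}" "permute_list p (map a [0..<N]) = xs"
    by (rule mset_eq_permutation[OF assms])
  show ?thesis
  proof (rule that)
    show "p permutes {..<N}" using p(1) by simp
    fix i assume "i < N"
    thus "xs ! i = a (p i)"
      using p permutes_in_image[OF p(1), of i] permute_list_nth[OF p(1), of i] by simp
  qed
qed

lemma decreasing_rearrangement_permutes:
  assumes "inj_on a {..<N}"
  obtains p where "p permutes {..<N}" "\<And>i. i < N \<Longrightarrow> decreasing_rearrangement N a ! i = a (p i)"
    "\<And>i j. i < j \<Longrightarrow> j < N \<Longrightarrow> decreasing_rearrangement N a ! j < decreasing_rearrangement N a ! i"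
proof -
  let ?d = "decreasing_rearrangement N a"
  have "mset ?d = mset (map a [0..<N])" by (simp add: decreasing_rearrangement_def)
  then obtain p where p: "p permutes {..<N}" "\<And>i. i < N \<Longrightarrow> ?d ! i = a (p i)"
    by (rule permutes_of_mset_eq) blast
  have "?d ! j < ?d ! i" if ij: "i < j" "j < N" for i j
  proof -
    have "sorted (rev ?d)" "length ?d = N" by (simp_all add: decreasing_rearrangement_def)
    hence "?d ! j \<le> ?d ! i" using ij by (intro sorted_rev_nth_mono) auto
    moreover have "a (p j) \<noteq> a (p i)"
      using inj_onD[OF assms, of "p j" "p i"] permutes_in_image[OF p(1)] permutes_inj[OF p(1)] ij
      by (auto simp: inj_eq)
    ultimately show ?thesis using p(2) ij by simp
  qed
  with p show ?thesis by (rule that)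
qed

lemma obtain_sorting_permutation:
  fixes x :: "nat \<Rightarrow> real"
  obtains p where "p permutes {..<N}" "mono_on {..<N} (x \<circ> p)"
proof -
  let ?s = "sort (map x [0..<N])"
  have "mset ?s = mset (map x [0..<N])" by simp
  then obtain p where p: "p permutes {..<N}" "\<And>i. i < N \<Longrightarrow> ?s ! i = x (p i)"
    by (rule permutes_of_mset_eq) blast
  have "x (p i) \<le> x (p j)" if "i \<le> j" "j < N" for i j
    using p(2)[of i] p(2)[of j] sorted_nth_mono[of ?s i j] that by simp
  hence "mono_on {..<N} (x \<circ> p)" by (auto simp: mono_on_def)
  with p(1) show ?thesis by (rule that)
qed

lemma det_gen_vandermonde_mat:
  assumes "\<And>i. i < N \<Longrightarrow> 0 < u i"
  shows "det (gen_vandermonde_mat N u a) = exp_det N (\<lambda>i. ln (u i)) a"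
  unfolding gen_vandermonde_mat_def exp_det_def
  using assms by (intro arg_cong[where f = det] eq_matI) (force simp: powr_def)+

theorem theorem1p14:
  fixes N :: nat and m n :: "nat \<Rightarrow> real"
  assumes "N > 0"
    and "inj_on m {..<N}"
    and "inj_on n {..<N}"
  shows "(\<forall>u :: nat \<Rightarrow> real. (\<forall>i<N. u i \<ge> 1) \<longrightarrow>
            \<bar>Determinant.det (gen_vandermonde_mat N u m)\<bar> / \<bar>vandermonde_prod N m\<bar>
              \<ge> \<bar>Determinant.det (gen_vandermonde_mat N u n)\<bar> / \<bar>vandermonde_prod N n\<bar>)
         \<longleftrightarrow> weakly_majorizes N m n"
proof -
  define a where "a i = decreasing_rearrangement N m ! i" for i
  define b where "b i = decreasing_rearrangement N n ! i" for i
  obtain p where p: "p permutes {..<N}" "\<And>i. i < N \<Longrightarrow> a i = m (p i)"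
      and a: "\<And>i j. i < j \<Longrightarrow> j < N \<Longrightarrow> a j < a i"
    unfolding a_def by (rule decreasing_rearrangement_permutes[OF assms(2)]) blast
  obtain q where q: "q permutes {..<N}" "\<And>i. i < N \<Longrightarrow> b i = n (q i)"
      and b: "\<And>i j. i < j \<Longrightarrow> j < N \<Longrightarrow> b j < b i"
    unfolding b_def by (rule decreasing_rearrangement_permutes[OF assms(3)]) blast
  have "vandermonde_ratio N x a = vandermonde_ratio N x (m \<circ> p)" for x
    by (rule vandermonde_ratio_cong) (simp_all add: p)
  hence ra: "vandermonde_ratio N x m = vandermonde_ratio N x a" for x
    by (simp add: vandermonde_ratio_permute p)
  have "vandermonde_ratio N x b = vandermonde_ratio N x (n \<circ> q)" for x
    by (rule vandermonde_ratio_cong) (simp_all add: q)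
  hence rb: "vandermonde_ratio N x n = vandermonde_ratio N x b" for x
    by (simp add: vandermonde_ratio_permute q)
  have ratio: "\<bar>det (gen_vandermonde_mat N u c)\<bar> / \<bar>vandermonde_prod N c\<bar>
      = vandermonde_ratio N (\<lambda>i. ln (u i)) c" if "\<forall>i<N. u i \<ge> 1" for u c
    using that by (subst det_gen_vandermonde_mat) (auto simp: vandermonde_ratio_def intro: less_le_trans[of 0 1])
  have maj: "weakly_majorizes N m n \<longleftrightarrow> (\<forall>k\<in>{1..N}. (\<Sum>j<k. b j) \<le> (\<Sum>j<k. a j))"
    by (simp add: weakly_majorizes_def a_def b_def)
  show ?thesis
  proof
    assume *: "\<forall>u :: nat \<Rightarrow> real. (\<forall>i<N. u i \<ge> 1) \<longrightarrow>
            \<bar>det (gen_vandermonde_mat N u m)\<bar> / \<bar>vandermonde_prod N m\<bar>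
              \<ge> \<bar>det (gen_vandermonde_mat N u n)\<bar> / \<bar>vandermonde_prod N n\<bar>"
    have "vandermonde_ratio N x b \<le> vandermonde_ratio N x a" if "\<forall>i<N. 0 \<le> x i" for x
    proof -
      have "\<forall>i<N. exp (x i) \<ge> 1" using that by simp
      with *[rule_format, of "\<lambda>i. exp (x i)"] show ?thesis
        by (simp only: ratio[of "\<lambda>i. exp (x i)"] ln_exp ra rb)
    qed
    thus "weakly_majorizes N m n"
      unfolding maj using majorize_of_vandermonde_ratio_le[of N a b] a b by simp
  next
    assume "weakly_majorizes N m n"
    hence sums: "(\<Sum>j<k. b j) \<le> (\<Sum>j<k. a j)" if "k \<le> N" for k
      using that unfolding maj by (cases "k = 0") auto
    show "\<forall>u :: nat \<Rightarrow> real. (\<forall>i<N. u i \<ge> 1) \<longrightarrow>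
            \<bar>det (gen_vandermonde_mat N u m)\<bar> / \<bar>vandermonde_prod N m\<bar>
              \<ge> \<bar>det (gen_vandermonde_mat N u n)\<bar> / \<bar>vandermonde_prod N n\<bar>"
    proof (intro allI impI)
      fix u :: "nat \<Rightarrow> real" assume u: "\<forall>i<N. u i \<ge> 1"
      define x where "x = (\<lambda>i. ln (u i))"
      obtain s where s: "s permutes {..<N}" "mono_on {..<N} (x \<circ> s)"
        by (rule obtain_sorting_permutation)
      have "\<forall>i<N. 0 \<le> (x \<circ> s) i"
        using u permutes_in_image[OF s(1)] by (auto simp: x_def)
      hence "vandermonde_ratio N (x \<circ> s) b \<le> vandermonde_ratio N (x \<circ> s) a"
        by (intro vandermonde_ratio_mono_majorize s a b sums)
      hence "vandermonde_ratio N x n \<le> vandermonde_ratio N x m"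
        by (simp add: vandermonde_ratio_permute s ra rb)
      thus "\<bar>det (gen_vandermonde_mat N u m)\<bar> / \<bar>vandermonde_prod N m\<bar>
              \<ge> \<bar>det (gen_vandermonde_mat N u n)\<bar> / \<bar>vandermonde_prod N n\<bar>"
        by (simp add: ratio[OF u] x_def)
    qed
  qed
qed

end
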